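(* The following realizability algebra is coherent: the standard realizability algebra with exactly two stack constants $\pi^0,\pi^1$ and one term constant $\mathrm d$, in which $\perp\!\!\!\perp$ is defined by $\Lambda\star\Pi\setminus\perp\!\!\!\perp=(\Lambda^0\star\Pi^0\setminus\perp\!\!\!\perp^0_0)\cup(\Lambda^1\star\Pi^1\setminus\perp\!\!\!\perp^1_1)$.
   Context: Terms and stacks of a standard realizability algebra are finite sequences over the alphabet $B,C,I,K,W,\mathrm{cc},k,\cdot,(,),[,]$ together with term constants and stack constants: $B,C,I,K,W,\mathrm{cc}$ and term constants are terms; if $t,u$ are terms then $(t)u$ is a term; if $\pi$ is a stack then $k[\pi]$ (written $k_\pi$) is a term; stack constants are stacks; if $t$ is a term and $\pi$ a stack then $t\cdot\pi$ is a stack. A process $t\star\pi$ is a pair (term, stack). Execution $\succ$ is the least reflexive transitive relation with $(\xi)\eta\star\pi\succ\xi\star\eta\cdot\pi$, $I\star\xi\cdot\pi\succ\xi\star\pi$, $K\star\xi\cdot\eta\cdot\pi\succ\xi\star\pi$, $W\star\xi\cdot\eta\cdot\pi\succ\xi\star\eta\cdot\eta\cdot\pi$, $C\star\xi\cdot\eta\cdot\zeta\cdot\pi\succ\xi\star\zeta\cdot\eta\cdot\pi$, $B\star\xi\cdot\eta\cdot\zeta\cdot\pi\succ\xi\star(\eta)\zeta\cdot\pi$, $\mathrm{cc}\star\xi\cdot\pi\succ\xi\star k_\pi\cdot\pi$, $k_\pi\star\xi\cdot\varpi\succ\xi\star\pi$. Proof-like terms are terms not containing $k$ (equivalently no stack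 constant). Integers: $\underline0=KI$, $\underline{n+1}=(\sigma)\underline n$, $\sigma=(BW)(B)B$. Here the only stack constants are $\pi^0,\pi^1$ and the only term constant is $\mathrm d$. For $i\in\{0,1\}$, $\Lambda^i$ (resp. $\Pi^i$) is the set of terms (resp. stacks) containing only the stack constant $\pi^i$ (stack constants other than $\pi^i$ do not occur). For $i,j\in\{0,1\}$, $\perp\!\!\!\perp^i_j$ is the least set $P\subseteq\Lambda^i\star\Pi^i$ such that: (1) $\mathrm d\star\underline j\cdot\pi\in P$ for every $\pi\in\Pi^i$; (2) if $\xi\star\pi\in\Lambda^i\star\Pi^i$, $\xi\star\pi\succ\xi'\star\pi'$ and $\xi'\star\pi'\in P$ then $\xi\star\pi\in P$; (3) if at least two of $\xi\star\pi,\eta\star\pi,\zeta\star\pi$ are in $P$, then $\mathrm d\star\underline2\cdot\xi\cdot\eta\cdot\zeta\cdot\pi\in P$. Coherence: for every proof-like term $\theta$ there exists a stack $\pi$ with $\theta\star\pi\notin\perp\!\!\!\perp$. *)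

theory Defs
  imports Main
begin

text \<open>
  Terms and stacks over a type \<open>'c\<close> of term constants and a type \<open>'s\<close> of stack constants.
  \<open>App t u\<close> is \<open>(t)u\<close>, and \<open>Cont \<pi>\<close> is the continuation \<open>k[\<pi>]\<close>.
  \<open>trm_sconsts\<close> and \<open>stk_sconsts\<close> give the set of stack constants occurring in a term or a stack.
\<close>

datatype (trm_tconsts: 'c, trm_sconsts: 's) trm =
    cB | cC | cI | cK | cW | cCC
  | TConst 'c
  | App "('c, 's) trm" "('c, 's) trm"
  | Cont "('c, 's) stk"
and (stk_tconsts: 'c, stk_sconsts: 's) stk =
    SConst 's
  | Push "('c, 's) trm" "('c, 's) stk"  (infixr \<open>\<cdot>\<close> 65)

type_synonym ('c, 's) process = "('c, 's) trm \<times> ('c, 's) stk"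

abbreviation process_of :: "('c, 's) trm \<Rightarrow> ('c, 's) stk \<Rightarrow> ('c, 's) process"  (infix \<open>\<star>\<close> 60)
  where "t \<star> \<pi> \<equiv> (t, \<pi>)"

inductive step :: "('c, 's) process \<Rightarrow> ('c, 's) process \<Rightarrow> bool" where
  step_App:  "step (App \<xi> \<eta> \<star> \<pi>) (\<xi> \<star> \<eta> \<cdot> \<pi>)"
| step_I:    "step (cI \<star> \<xi> \<cdot> \<pi>) (\<xi> \<star> \<pi>)"
| step_K:    "step (cK \<star> \<xi> \<cdot> \<eta> \<cdot> \<pi>) (\<xi> \<star> \<pi>)"
| step_W:    "step (cW \<star> \<xi> \<cdot> \<eta> \<cdot> \<pi>) (\<xi> \<star> \<eta> \<cdot> \<eta> \<cdot> \<pi>)"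
| step_C:    "step (cC \<star> \<xi> \<cdot> \<eta> \<cdot> \<zeta> \<cdot> \<pi>) (\<xi> \<star> \<zeta> \<cdot> \<eta> \<cdot> \<pi>)"
| step_B:    "step (cB \<star> \<xi> \<cdot> \<eta> \<cdot> \<zeta> \<cdot> \<pi>) (\<xi> \<star> App \<eta> \<zeta> \<cdot> \<pi>)"
| step_CC:   "step (cCC \<star> \<xi> \<cdot> \<pi>) (\<xi> \<star> Cont \<pi> \<cdot> \<pi>)"
| step_Cont: "step (Cont \<pi> \<star> \<xi> \<cdot> \<rho>) (\<xi> \<star> \<pi>)"

abbreviation exec :: "('c, 's) process \<Rightarrow> ('c, 's) process \<Rightarrow> bool"  (infix \<open>\<succ>\<close> 50)
  where "p \<succ> q \<equiv> step\<^sup>*\<^sup>* p q"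

text \<open>
  A term is proof-like if no continuation occurs in it; term constants are allowed.
\<close>

primrec proof_like :: "('c, 's) trm \<Rightarrow> bool" where
  "proof_like cB \<longleftrightarrow> True"
| "proof_like cC \<longleftrightarrow> True"
| "proof_like cI \<longleftrightarrow> True"
| "proof_like cK \<longleftrightarrow> True"
| "proof_like cW \<longleftrightarrow> True"
| "proof_like cCC \<longleftrightarrow> True"
| "proof_like (TConst c) \<longleftrightarrow> True"
| "proof_like (App t u) \<longleftrightarrow> proof_like t \<and> proof_like u"
| "proof_like (Cont \<pi>) \<longleftrightarrow> False"

lemma stk_sconsts_nonempty: "stk_sconsts \<pi> \<noteq> {}"
  by (induction \<pi> rule: stk.induct[of "\<lambda>_. True"]) auto

lemma proof_like_iff: "proof_like t \<longleftrightarrow> trm_sconsts t = {}"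
  by (induction t rule: trm.induct[of _ "\<lambda>_. True"]) (auto simp: stk_sconsts_nonempty)

definition suc_trm :: "('c, 's) trm" where
  "suc_trm = App (App cB cW) (App cB cB)"

primrec int_trm :: "nat \<Rightarrow> ('c, 's) trm" where
  "int_trm 0 = App cK cI"
| "int_trm (Suc n) = App suc_trm (int_trm n)"

text \<open>
  A standard realizability algebra on given constants is determined by its set \<open>P\<close> of processes
  (the set usually written as a double orthogonality sign), which has to be closed under
  anti-execution.
\<close>

definition standard_realizability_algebra :: "('c, 's) process set \<Rightarrow> bool" where
  "standard_realizability_algebra P \<longleftrightarrow> (\<forall>p q. p \<succ> q \<longrightarrow> q \<in> P \<longrightarrow> p \<in> P)"

definition coherent :: "('c, 's) process set \<Rightarrow> bool" where
  "coherent P \<longleftrightarrow> (\<forall>\<theta>. proof_like \<theta> \<longrightarrow> (\<exists>\<pi>. \<theta> \<star> \<pi> \<notin> P))"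

datatype tconst = Const_d
datatype sconst = Pi0 | Pi1

abbreviation d :: "(tconst, 's) trm" where
  "d \<equiv> TConst Const_d"

definition \<Lambda> :: "sconst \<Rightarrow> (tconst, sconst) trm set" where
  "\<Lambda> i = {t. trm_sconsts t \<subseteq> {i}}"

definition \<Pi> :: "sconst \<Rightarrow> (tconst, sconst) stk set" where
  "\<Pi> i = {\<pi>. stk_sconsts \<pi> \<subseteq> {i}}"

text \<open>
  The index \<open>i\<close> is given by its stack constant and \<open>j\<close> by a number, of which only \<open>0\<close> and \<open>1\<close>
  are used below. In the last rule \<open>\<xi>\<close>, \<open>\<eta>\<close>, \<open>\<zeta>\<close> all range over \<open>\<Lambda> i\<close>: otherwise the conclusion
  could leave \<open>\<Lambda> i \<times> \<Pi> i\<close>. ``At least two of the three'' is counted by position.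
\<close>

inductive_set pole_at :: "sconst \<Rightarrow> nat \<Rightarrow> (tconst, sconst) process set"
  for i :: sconst and j :: nat
where
  pole_at_int: "\<pi> \<in> \<Pi> i \<Longrightarrow> d \<star> int_trm j \<cdot> \<pi> \<in> pole_at i j"
| pole_at_exec:
    "\<lbrakk>\<xi> \<star> \<pi> \<in> \<Lambda> i \<times> \<Pi> i; \<xi> \<star> \<pi> \<succ> \<xi>' \<star> \<pi>'; \<xi>' \<star> \<pi>' \<in> pole_at i j\<rbrakk>
      \<Longrightarrow> \<xi> \<star> \<pi> \<in> pole_at i j"
| pole_at_two:
    "\<lbrakk>\<xi> \<in> \<Lambda> i; \<eta> \<in> \<Lambda> i; \<zeta> \<in> \<Lambda> i; \<pi> \<in> \<Pi> i;
      (\<xi> \<star> \<pi> \<in> pole_at i j \<and> \<eta> \<star> \<pi> \<in> pole_at i j) \<or>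
      (\<xi> \<star> \<pi> \<in> pole_at i j \<and> \<zeta> \<star> \<pi> \<in> pole_at i j) \<or>
      (\<eta> \<star> \<pi> \<in> pole_at i j \<and> \<zeta> \<star> \<pi> \<in> pole_at i j)\<rbrakk>
      \<Longrightarrow> d \<star> int_trm 2 \<cdot> \<xi> \<cdot> \<eta> \<cdot> \<zeta> \<cdot> \<pi> \<in> pole_at i j"

definition pole :: "(tconst, sconst) process set" where
  "pole = - ((\<Lambda> Pi0 \<times> \<Pi> Pi0 - pole_at Pi0 0) \<union> (\<Lambda> Pi1 \<times> \<Pi> Pi1 - pole_at Pi1 1))"

lemma int_trm_sconsts: "trm_sconsts (int_trm n) = {}"
  by (induction n) (auto simp: suc_trm_def)

lemma pole_at_subset: "pole_at i j \<subseteq> \<Lambda> i \<times> \<Pi> i"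
proof (rule subrelI)
  fix \<xi> \<pi> assume "\<xi> \<star> \<pi> \<in> pole_at i j"
  then show "\<xi> \<star> \<pi> \<in> \<Lambda> i \<times> \<Pi> i"
    by (induction rule: pole_at.induct) (auto simp: \<Lambda>_def \<Pi>_def int_trm_sconsts)
qed

lemma step_closed: "step p q \<Longrightarrow> p \<in> \<Lambda> i \<times> \<Pi> i \<Longrightarrow> q \<in> \<Lambda> i \<times> \<Pi> i"
  by (induction rule: step.induct) (auto simp: \<Lambda>_def \<Pi>_def)

lemma exec_closed: "p \<succ> q \<Longrightarrow> p \<in> \<Lambda> i \<times> \<Pi> i \<Longrightarrow> q \<in> \<Lambda> i \<times> \<Pi> i"
  by (induction rule: rtranclp_induct) (use step_closed in blast)+

lemma standard_realizability_algebra_pole: "standard_realizability_algebra pole"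
proof -
  have *: "q \<in> \<Lambda> i \<times> \<Pi> i - pole_at i j"
    if "p \<succ> q" "p \<in> \<Lambda> i \<times> \<Pi> i - pole_at i j" for p q i j
    using that exec_closed[of p q i]
    by (cases p; cases q) (auto intro: pole_at_exec)
  show ?thesis
    unfolding standard_realizability_algebra_def pole_def using * by blast
qed

end

theory Submission
  imports Defs
begin

text \<open>
  Execution is deterministic and a process with head \<open>d\<close> is stuck, so for \<open>j \<noteq> j'\<close> in \<open>{0, 1}\<close> the
  sets \<open>pole_at i j\<close> and \<open>pole_at i j'\<close> are disjoint: the only stuck processes that could lie in both
  have head \<open>d\<close> and first argument \<open>2\<close>, and if two out of three processes are in one set and two
  in the other, then one of the three is in both, so induction applies. Now if a proof-like \<open>\<theta>\<close>
  violated coherence, both \<open>\<theta> \<star> \<pi>\<^sup>0\<close> would be in \<open>pole_at Pi0 0\<close> and \<open>\<theta> \<star> \<pi>\<^sup>1\<close> in \<open>pole_at Pi1 1\<close>;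
  renaming \<open>\<pi>\<^sup>1\<close> to \<open>\<pi>\<^sup>0\<close> does not change \<open>\<theta>\<close>, so \<open>\<theta> \<star> \<pi>\<^sup>0\<close> would be in both
  \<open>pole_at Pi0 0\<close> and \<open>pole_at Pi0 1\<close>.
\<close>

lemma step_deterministic: "step p q \<Longrightarrow> step p q' \<Longrightarrow> q = q'"
  by (induction rule: step.induct) (erule step.cases; simp)+

lemma exec_linear: "p \<succ> q \<Longrightarrow> p \<succ> q' \<Longrightarrow> q \<succ> q' \<or> q' \<succ> q"
proof (induction rule: rtranclp_induct)
  case (step q r)
  then show ?case
    by (metis converse_rtranclpE r_into_rtranclp rtranclp_trans step_deterministic)
qed simp

lemma exec_TConst: "TConst c \<star> \<pi> \<succ> q \<longleftrightarrow> q = TConst c \<star> \<pi>"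
proof
  assume "TConst c \<star> \<pi> \<succ> q"
  then show "q = TConst c \<star> \<pi>"
    by (cases rule: converse_rtranclpE) (auto elim: step.cases)
qed simp

lemma int_trm_inject: "int_trm m = int_trm n \<longleftrightarrow> m = n"
proof (induction m arbitrary: n)
  case 0
  show ?case by (cases n) (auto simp: suc_trm_def)
next
  case (Suc m)
  then show ?case by (cases n) (auto simp: suc_trm_def)
qed

text \<open>Anti-execution closes the set backwards only. Forwards, determinism puts
  \<open>q\<close> and the reduct given by the rule on one path: if \<open>q\<close> comes later,
  induction applies; if earlier, anti-execution does.\<close>

lemma pole_at_forward:
  assumes "t \<star> \<rho> \<in> pole_at i j" and "t \<star> \<rho> \<succ> q"
  shows "q \<in> pole_at i j"
  using assms
proof (induction arbitrary: q rule: pole_at.induct)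
  case (pole_at_int \<pi>)
  then show ?case by (auto simp: exec_TConst intro: pole_at.pole_at_int)
next
  case (pole_at_exec \<xi> \<pi> \<xi>' \<pi>')
  from exec_linear[OF pole_at_exec.hyps(2) pole_at_exec.prems] show ?case
  proof
    assume "\<xi>' \<star> \<pi>' \<succ> q"
    then show ?thesis by (rule pole_at_exec.IH)
  next
    assume "q \<succ> \<xi>' \<star> \<pi>'"
    moreover have "q \<in> \<Lambda> i \<times> \<Pi> i"
      using pole_at_exec.prems pole_at_exec.hyps(1) by (rule exec_closed)
    ultimately show ?thesis
      using pole_at_exec.hyps(3) by (cases q) (auto intro: pole_at.pole_at_exec)
  qed
next
  case (pole_at_two \<xi> \<eta> \<zeta> \<pi>)
  then have "q = d \<star> int_trm 2 \<cdot> \<xi> \<cdot> \<eta> \<cdot> \<zeta> \<cdot> \<pi>" by (simp add: exec_TConst)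
  with pole_at_two show ?case by (auto intro!: pole_at.pole_at_two)
qed

text \<open>Inversion without the anti-execution rule: \<open>d\<close> is stuck, so that rule can
  only repeat the same process.\<close>

lemma pole_at_d_cases:
  assumes "d \<star> \<rho> \<in> pole_at i j"
  obtains \<pi> where "\<rho> = int_trm j \<cdot> \<pi>"
  | \<xi> \<eta> \<zeta> \<pi> where "\<rho> = int_trm 2 \<cdot> \<xi> \<cdot> \<eta> \<cdot> \<zeta> \<cdot> \<pi>"
      "(\<xi> \<star> \<pi> \<in> pole_at i j \<and> \<eta> \<star> \<pi> \<in> pole_at i j) \<or>
       (\<xi> \<star> \<pi> \<in> pole_at i j \<and> \<zeta> \<star> \<pi> \<in> pole_at i j) \<or>
       (\<eta> \<star> \<pi> \<in> pole_at i j \<and> \<zeta> \<star> \<pi> \<in> pole_at i j)"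
  using assms
proof (induction "d :: (tconst, sconst) trm" \<rho> arbitrary: thesis rule: pole_at.induct)
  case (pole_at_int \<pi>)
  show ?case by (rule pole_at_int.prems(1)) (rule refl)
next
  case (pole_at_exec \<pi> \<xi>' \<pi>')
  then have eq: "\<xi>' = d" "\<pi>' = \<pi>" by (simp_all add: exec_TConst)
  show ?case
    using eq(1)
  proof (rule pole_at_exec.hyps(4), unfold eq(2))
    show thesis if "\<pi> = int_trm j \<cdot> \<rho>" for \<rho>
      using that by (rule pole_at_exec.prems(1))
  qed (rule pole_at_exec.prems(2))
next
  case (pole_at_two \<xi> \<eta> \<zeta> \<pi>)
  show ?case by (rule pole_at_two.prems(2)[OF refl]) (use pole_at_two.hyps in blast)
qed

text \<open>Excluding 2 as an index keeps the two rules with head \<open>d\<close> apart.\<close>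

lemma pole_at_disjoint:
  assumes "t \<star> \<rho> \<in> pole_at i j" and "j \<noteq> j'" "j \<noteq> 2" "j' \<noteq> 2"
  shows "t \<star> \<rho> \<notin> pole_at i j'"
  using assms(1)
proof (induction rule: pole_at.induct)
  case (pole_at_int \<pi>)
  show ?case
  proof
    assume "d \<star> int_trm j \<cdot> \<pi> \<in> pole_at i j'"
    then show False using assms(2,3) by (cases rule: pole_at_d_cases) (auto simp: int_trm_inject)
  qed
next
  case (pole_at_exec \<xi> \<pi> \<xi>' \<pi>')
  \<comment> \<open>Membership in \<open>pole_at i j'\<close> would pass forwards to the reduct,
    against the induction hypothesis.\<close>
  then show ?case using pole_at_forward by blast
next
  case (pole_at_two \<xi> \<eta> \<zeta> \<pi>)
  show ?case
  proof
    assume "d \<star> int_trm 2 \<cdot> \<xi> \<cdot> \<eta> \<cdot> \<zeta> \<cdot> \<pi> \<in> pole_at i j'"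
    then show False
      using pole_at_two.IH assms(4) by (cases rule: pole_at_d_cases) (auto simp: int_trm_inject)
  qed
qed

lemma step_map:
  "step p q \<Longrightarrow> step (map_prod (map_trm f g) (map_stk f g) p) (map_prod (map_trm f g) (map_stk f g) q)"
  by (induction rule: step.induct) (auto intro: step.intros)

lemma exec_map:
  "p \<succ> q \<Longrightarrow> map_prod (map_trm f g) (map_stk f g) p \<succ> map_prod (map_trm f g) (map_stk f g) q"
  by (induction rule: rtranclp_induct) (auto intro: step_map rtranclp.rtrancl_into_rtrancl)

lemma map_int_trm: "map_trm f g (int_trm n) = int_trm n"
  by (induction n) (auto simp: suc_trm_def)

text \<open>All stack constants become \<open>k\<close>, so images meet the side conditions of the
  rules automatically.\<close>

lemma pole_at_rename:
  fixes i k :: sconst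
  defines "T \<equiv> map_trm id (\<lambda>_. k)" and "S \<equiv> map_stk id (\<lambda>_. k)"
  assumes "t \<star> \<rho> \<in> pole_at i j"
  shows "T t \<star> S \<rho> \<in> pole_at k j"
proof -
  have T: "T t \<in> \<Lambda> k" and S: "S \<pi> \<in> \<Pi> k" for t :: "(tconst, sconst) trm" and \<pi> :: "(tconst, sconst) stk"
    by (auto simp: T_def S_def \<Lambda>_def \<Pi>_def trm.set_map stk.set_map)
  from assms(3) show ?thesis
  proof (induction rule: pole_at.induct)
    case (pole_at_int \<pi>)
    then show ?case
      using pole_at.pole_at_int[OF S] by (simp add: T_def S_def map_int_trm)
  next
    case (pole_at_exec \<xi> \<pi> \<xi>' \<pi>')
    have "T \<xi> \<star> S \<pi> \<succ> T \<xi>' \<star> S \<pi>'"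
      using exec_map[OF pole_at_exec.hyps(2)] by (simp add: T_def S_def)
    with pole_at_exec.IH T S show ?case
      by (auto intro: pole_at.pole_at_exec)
  next
    case (pole_at_two \<xi> \<eta> \<zeta> \<pi>)
    then have "d \<star> int_trm 2 \<cdot> T \<xi> \<cdot> T \<eta> \<cdot> T \<zeta> \<cdot> S \<pi> \<in> pole_at k j"
      by (intro pole_at.pole_at_two T S) auto
    then show ?case by (simp add: T_def S_def map_int_trm)
  qed
qed

theorem theorem42: "coherent pole"
  unfolding coherent_def
proof (intro allI impI, rule ccontr)
  fix \<theta> :: "(tconst, sconst) trm"
  assume "proof_like \<theta>" and "\<nexists>\<pi>. \<theta> \<star> \<pi> \<notin> pole"
  then have closed: "trm_sconsts \<theta> = {}" and pole: "\<theta> \<star> \<pi> \<in> pole" for \<pi>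
    by (auto simp: proof_like_iff)
  \<comment> \<open>Without stack constants in \<theta>, each process lies in its own
    \<open>\<Lambda> i \<times> \<Pi> i\<close>, where \<open>pole\<close> forces membership in
    \<open>pole_at\<close>.\<close>
  have "\<theta> \<star> SConst Pi0 \<in> pole_at Pi0 0" "\<theta> \<star> SConst Pi1 \<in> pole_at Pi1 1"
    using pole[of "SConst Pi0"] pole[of "SConst Pi1"] closed by (auto simp: pole_def \<Lambda>_def \<Pi>_def)
  moreover have "map_trm id (\<lambda>_. Pi0) \<theta> = \<theta>"
    using closed by (intro trm.map_ident_strong) auto
  ultimately have "\<theta> \<star> SConst Pi0 \<in> pole_at Pi0 0" "\<theta> \<star> SConst Pi0 \<in> pole_at Pi0 1"
    using pole_at_rename[of \<theta> "SConst Pi1" Pi1 1 Pi0] by auto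
  then show False using pole_at_disjoint by fastforce
qed

end
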